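(* Let the data $X,K,X_j,\gamma_j,A,Y,\varphi,j,f,R,q,a_S$ satisfy the standing assumptions listed in the context, assume $\alpha_\varphi+\alpha_jc_j^2<m_A$, and let $j_c:X_j\to X_j^*$ be a linear operator such that $\|j_c(z)\|_{X_j^*}\le\alpha_c\|z\|_{X_j}$ and $\langle j_c(z),z\rangle_{X_j}\ge\alpha_j\|z\|_{X_j}^2$ for all $z\in X_j$. Let $T>0$, $N$ a positive integer, $k=T/N$, $1\le n\le N$, and let $h$ be a mesh parameter. Let $u_0^{kh},\dots,u_{n-1}^{kh}\in K^h$ be given, and let $u_n^{kh}\in K^h$ be the solution of $$\langle Au_n^{kh},v^h-u_n^{kh}\rangle+\varphi(\mathcal S_{n,L}^ku^{kh},u_n^{kh},v^h)-\varphi(\mathcal S_{n,L}^ku^{kh},u_n^{kh},u_n^{kh})+j^0(\gamma_ju_n^{kh};\gamma_jv^h-\gamma_ju_n^{kh})\ge\langle f_n,v^h-u_n^{kh}\rangle\quad\forall v^h\in K^h.$$ Let $\tilde u_{n,0}^{kh}\in K^h$ and let $\{\tilde u_{n,i}^{kh}\}_{i\ge1}\subset K^h$ satisfy, for every $i\ge1$ and every $v^h\in K^h$, $$\langle A\tilde u_{n,i}^{kh},v^h-\tilde u_{n,i}^{kh}\rangle+\varphi(\mathcal S_{n,L}^ku^{kh},\tilde u_{n,i-1}^{kh},v^h)-\varphi(\mathcal S_{n,L}^ku^{kh},\tilde u_{n,i-1}^{kh},\tilde u_{n,i}^{kh})+j^0(\gamma_j\tilde u_{n,i}^{kh};\gamma_jv^h-\gamma_j\tilde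 u_{n,i}^{kh})$$ $$+\langle j_c(\gamma_j\tilde u_{n,i}^{kh}),\gamma_jv^h-\gamma_j\tilde u_{n,i}^{kh}\rangle_{X_j}\ge\langle f_n,v^h-\tilde u_{n,i}^{kh}\rangle+\langle j_c(\gamma_j\tilde u_{n,i-1}^{kh}),\gamma_jv^h-\gamma_j\tilde u_{n,i}^{kh}\rangle_{X_j}.$$ Then the iteration converges linearly: $\tilde u_{n,i}^{kh}\to u_n^{kh}$ in $X$ as $i\to\infty$, linearly with the convergence rate $\rho=(\alpha_\varphi+\alpha_cc_j^2)/m_A$, which is independent of the time step $k$ and the mesh parameter $h$.
   Context: Notation. All spaces are real. $\mathbb R_+=[0,\infty)$; $X^*,X_j^*$ are topological duals; $\langle\cdot,\cdot\rangle$ is the duality pairing between $X^*$ and $X$, $\langle\cdot,\cdot\rangle_{X_j}$ the one between $X_j^*$ and $X_j$; $\mathcal L(\cdot;\cdot)$ denotes bounded linear operators, $\mathcal L(X)=\mathcal L(X;X)$. For a locally Lipschitz $j:X_j\to\mathbb R$, the Clarke directional derivative is $j^0(x;v)=\limsup_{y\to x,\lambda\downarrow0}\frac{j(y+\lambda v)-j(y)}{\lambda}$ and $\partial j(x)=\{\xi\in X_j^*: j^0(x;v)\ge\langle\xi,v\rangle_{X_j}\ \forall v\in X_j\}$. Standing assumptions on the data. $X$ is a reflexive Banach space, $K\subset X$ is closed and convex, $0\in K$. $X_j$ is a Banach space, $\gamma_j\in\mathcal L(X;X_j)$ and $c_j>0$ satisfies $\|\gamma_jv\|_{X_j}\le c_j\|v\|_X$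 for all $v\in X$. $A:X\to X^*$ is Lipschitz continuous with constant $L_A>0$ and strongly monotone: $\langle Av_1-Av_2,v_1-v_2\rangle\ge m_A\|v_1-v_2\|_X^2$ for all $v_1,v_2\in X$, with $m_A>0$. $Y$ is a normed space and $\varphi:Y\times K\times K\to\mathbb R$ is such that $\varphi(y,u,\cdot)$ is convex and lower semicontinuous on $K$ for all $y\in Y,u\in K$, and there are $\alpha_\varphi>0,\beta_\varphi>0$ with $\varphi(y_1,u_1,v_2)-\varphi(y_1,u_1,v_1)+\varphi(y_2,u_2,v_1)-\varphi(y_2,u_2,v_2)\le\alpha_\varphi\|u_1-u_2\|_X\|v_1-v_2\|_X+\beta_\varphi\|y_1-y_2\|_Y\|v_1-v_2\|_X$ for all $y_1,y_2\in Y$, $u_1,u_2,v_1,v_2\in K$. The function $j:X_j\to\mathbb R$ is locally Lipschitz; there are $c_0,c_1\ge0$ with $\|\xi\|_{X_j^*}\le c_0+c_1\|z\|_{X_j}$ for all $z\in X_j$, $\xi\in\partial j(z)$; there is $\alpha_j>0$ with $j^0(z_1;z_2-z_1)+j^0(z_2;z_1-z_2)\le\alpha_j\|z_1-z_2\|_{X_j}^2$ for all $z_1,z_2\in X_j$. $f\in C(\mathbb R_+;X^* )$. $R\in\mathcal L(X;Y)$, $q\in C(\mathbb R_+\times\mathbb R_+;\mathcal L(X))$, $a_S\in X$; these define the history-dependent operator $(\mathcal Sv)(t)=R\left(\int_0^tq(t,s)v(s)\,ds+a_S\right)$ for $v\in C(\mathbb R_+;X)$, of which $\mathcal S_{n,L}^k$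 below is a discretization. Discretization. $t_n=nk$, $0\le n\le N$, $f_n=f(t_n)$. For $n\ge1$, $\mathcal S_{n,L}^ku^{kh}=R\left(\frac k2q(t_n,t_0)u_0^{kh}+k\sum_{i=1}^{n-1}q(t_n,t_i)u_i^{kh}+\frac k2q(t_n,t_{n-1})u_{n-1}^{kh}+a_S\right)$ (empty sum $=0$), which depends only on $u_0^{kh},\dots,u_{n-1}^{kh}$. For each $h$, $X^h\subset X$ is a (finite-dimensional, conforming) finite element space associated with a mesh of size $h$ from a regular family of partitions, and $K^h=X^h\cap K$, which is nonempty, convex and closed.
   Formalization: The convergence of the iterates is asserted only when ρ<1, which the stated assumptions do not imply and without which it can fail; the error estimate with factor ρ at each step is proved without this. Also α_c≥0 is assumed, which is automatic unless X_j={0}. *)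

theory Defs
  imports "HOL-Analysis.Analysis"
begin

text \<open>The topological dual of a normed space is the type of bounded linear functionals into
  the reals, with the operator norm; the duality pairing is \<^const>\<open>blinfun_apply\<close>.\<close>

type_synonym 'a dual = "'a \<Rightarrow>\<^sub>L real"

definition reflexive :: "'a::real_normed_vector itself \<Rightarrow> bool" where
  "reflexive (_ :: 'a itself) \<longleftrightarrow>
     (\<forall>F :: 'a dual dual. \<exists>x :: 'a. \<forall>\<xi> :: 'a dual. blinfun_apply F \<xi> = blinfun_apply \<xi> x)"

definition finite_dim_subspace :: "'a::real_vector set \<Rightarrow> bool" where
  "finite_dim_subspace V \<longleftrightarrow> (\<exists>B. finite B \<and> V = span B)"

definition lsc_on :: "'a::topological_space set \<Rightarrow> ('a \<Rightarrow> real) \<Rightarrow> bool" where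
  "lsc_on S g \<longleftrightarrow> (\<forall>x\<in>S. \<forall>a. a < g x \<longrightarrow> (\<forall>\<^sub>F y in at x within S. a < g y))"

definition locally_lipschitz :: "('a::metric_space \<Rightarrow> real) \<Rightarrow> bool" where
  "locally_lipschitz g \<longleftrightarrow> (\<forall>x. \<exists>r>0. \<exists>L. L-lipschitz_on (cball x r) g)"

text \<open>The upper limit is taken in the extended reals, where it always exists; it is finite for
  locally Lipschitz functions, so \<^const>\<open>real_of_ereal\<close> loses nothing there. The
  filter \<^term>\<open>nhds x\<close> admits \<open>y = x\<close>; in a nontrivial space this does not
  change the value when \<open>g\<close> is continuous.\<close>

definition clarke_deriv :: "('a::real_normed_vector \<Rightarrow> real) \<Rightarrow> 'a \<Rightarrow> 'a \<Rightarrow> real" where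
  "clarke_deriv g x v =
     real_of_ereal (Limsup (nhds x \<times>\<^sub>F at_right 0)
       (\<lambda>(y, t). ereal ((g (y + t *\<^sub>R v) - g y) / t)))"

definition clarke_subdiff :: "('a::real_normed_vector \<Rightarrow> real) \<Rightarrow> 'a \<Rightarrow> 'a dual set" where
  "clarke_subdiff g x = {\<xi>. \<forall>v. clarke_deriv g x v \<ge> blinfun_apply \<xi> v}"

text \<open>Modified trapezoidal discretization, at the node \<open>n * k\<close> with \<open>n \<ge> 1\<close>, of the
  history-dependent operator with value \<open>R (\<integral>\<^sub>0\<^sup>t q (t, s) (v s) ds + a)\<close> at time \<open>t\<close>. The last
  half-step uses the value at the previous node, so that only \<open>u 0, \<dots>, u (n - 1)\<close> enter.\<close>

definition S_disc ::
  "('x::real_normed_vector \<Rightarrow>\<^sub>L 'y::real_normed_vector) \<Rightarrow> (real \<times> real \<Rightarrow> 'x \<Rightarrow>\<^sub>L 'x) \<Rightarrow> 'x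
     \<Rightarrow> real \<Rightarrow> nat \<Rightarrow> (nat \<Rightarrow> 'x) \<Rightarrow> 'y" where
  "S_disc R q a k n u =
     blinfun_apply R
       ((k / 2) *\<^sub>R blinfun_apply (q (real n * k, 0)) (u 0)
        + k *\<^sub>R (\<Sum>i\<in>{1..n-1}. blinfun_apply (q (real n * k, real i * k)) (u i))
        + (k / 2) *\<^sub>R blinfun_apply (q (real n * k, real (n - 1) * k)) (u (n - 1))
        + a)"

end

theory Submission
  imports Defs
begin

text \<open>
  Test the inequality for the solution \<open>u\<close> with the new iterate \<open>w\<close>, the inequality for \<open>w\<close> with
  \<open>u\<close>, and add the two. The load cancels, and so does the history term, because both problems
  are posed with the same history. Strong monotonicity makes the two operator terms
  together worth at least \<open>m \<parallel>w - u\<parallel>\<^sup>2\<close>, while the nonconvexity of the potential can cost up to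
  \<open>\<alpha> \<parallel>\<gamma> w - \<gamma> u\<parallel>\<^sup>2\<close>. The linear operator added to both sides of the iteration is there to pay
  this cost: writing \<open>j\<^sub>c (\<gamma> w) - j\<^sub>c (\<gamma> p) = j\<^sub>c (\<gamma> w - \<gamma> u) - j\<^sub>c (\<gamma> p - \<gamma> u)\<close> with \<open>p\<close> the
  previous iterate, coercivity of the first part absorbs the nonconvexity. What is left on the
  right, the second part and the defect from freezing the second argument of the convex term
  at \<open>p\<close>, is bilinear in \<open>\<parallel>p - u\<parallel>\<close> and \<open>\<parallel>w - u\<parallel>\<close>. One factor \<open>\<parallel>w - u\<parallel>\<close> cancels, which is the
  contraction in \<open>stabilized_step_contraction\<close>. Its factor depends only on the
  constants of the data, so it is the same for every finite-dimensional subspace and time step.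
  Iterating it yields convergence when the factor is less than one.
\<close>

text \<open>One step of the iteration, from \<open>p\<close> to \<open>w\<close>, compared with the exact solution \<open>u\<close>. The
  bifunction \<open>\<psi>\<close> stands for the convex term with its history argument fixed, and \<open>D\<close> for the
  Clarke derivative, which enters through its relaxed monotonicity. The constant \<open>\<alpha>\<close> is absent
  from the conclusion because it cancels between \<open>relaxed\<close> and \<open>coercive\<close>.\<close>

lemma stabilized_step_contraction:
  fixes A :: "'x::real_normed_vector \<Rightarrow> 'x dual"
    and \<gamma> :: "'x \<Rightarrow>\<^sub>L 'z::real_normed_vector"
    and \<psi> :: "'x \<Rightarrow> 'x \<Rightarrow> real"
    and D :: "'z \<Rightarrow> 'z \<Rightarrow> real"
    and J :: "'z \<Rightarrow> 'z dual"
    and l :: "'x dual"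
    and u p w :: 'x
  assumes m: "m > 0" and b: "b \<ge> 0" and c: "c \<ge> 0" and a: "a \<ge> 0"
    and monotone: "m * (norm (w - u))\<^sup>2 \<le> blinfun_apply (A w - A u) (w - u)"
    and trace: "\<And>v. norm (blinfun_apply \<gamma> v) \<le> c * norm v"
    and freezing: "\<psi> u w - \<psi> u u + \<psi> p u - \<psi> p w \<le> a * norm (u - p) * norm (u - w)"
    and relaxed: "\<And>x y. D x (y - x) + D y (x - y) \<le> \<alpha> * (norm (x - y))\<^sup>2"
    and linear: "linear J"
    and bounded: "\<And>z. norm (J z) \<le> b * norm z"
    and coercive: "\<And>z. \<alpha> * (norm z)\<^sup>2 \<le> blinfun_apply (J z) z"
    and solution: "blinfun_apply l (w - u)
       \<le> blinfun_apply (A u) (w - u) + \<psi> u w - \<psi> u u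
         + D (blinfun_apply \<gamma> u) (blinfun_apply \<gamma> w - blinfun_apply \<gamma> u)"
    and step: "blinfun_apply l (u - w)
         + blinfun_apply (J (blinfun_apply \<gamma> p)) (blinfun_apply \<gamma> u - blinfun_apply \<gamma> w)
       \<le> blinfun_apply (A w) (u - w) + \<psi> p u - \<psi> p w
         + D (blinfun_apply \<gamma> w) (blinfun_apply \<gamma> u - blinfun_apply \<gamma> w)
         + blinfun_apply (J (blinfun_apply \<gamma> w)) (blinfun_apply \<gamma> u - blinfun_apply \<gamma> w)"
  shows "norm (w - u) \<le> (a + b * c\<^sup>2) / m * norm (p - u)"
proof -
  define d where "d = blinfun_apply \<gamma> w - blinfun_apply \<gamma> u"
  define d' where "d' = blinfun_apply \<gamma> p - blinfun_apply \<gamma> u"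
  have flip: "blinfun_apply \<gamma> u - blinfun_apply \<gamma> w = - d" "u - w = - (w - u)"
    by (simp_all add: d_def)
  have d_le: "norm d \<le> c * norm (w - u)" and d'_le: "norm d' \<le> c * norm (p - u)"
    using trace[of "w - u"] trace[of "p - u"] by (simp_all add: d_def d'_def blinfun.diff_right)
  have D_sum: "D (blinfun_apply \<gamma> u) d + D (blinfun_apply \<gamma> w) (- d) \<le> \<alpha> * (norm d)\<^sup>2"
    using relaxed[of "blinfun_apply \<gamma> u" "blinfun_apply \<gamma> w", unfolded flip(1) d_def[symmetric]]
    by simp
  have split: "J (blinfun_apply \<gamma> w) - J (blinfun_apply \<gamma> p) = J d - J d'"
    by (simp add: d_def d'_def linear_diff[OF linear])
  have lagged: "blinfun_apply (J d') d \<le> b * c\<^sup>2 * (norm (p - u) * norm (w - u))"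
  proof -
    have "blinfun_apply (J d') d \<le> norm (J d') * norm d"
      using norm_blinfun[of "J d'" d] by simp
    also have "\<dots> \<le> (b * norm d') * norm d"
      by (intro mult_right_mono bounded) simp
    also have "\<dots> \<le> (b * (c * norm (p - u))) * (c * norm (w - u))"
      using b c by (intro mult_mono mult_left_mono d_le d'_le) auto
    finally show ?thesis by (simp add: power2_eq_square mult_ac)
  qed
  have stabilizer: "blinfun_apply (J (blinfun_apply \<gamma> w)) (- d) - blinfun_apply (J (blinfun_apply \<gamma> p)) (- d)
      \<le> b * c\<^sup>2 * (norm (p - u) * norm (w - u)) - \<alpha> * (norm d)\<^sup>2"
  proof -
    have "blinfun_apply (J (blinfun_apply \<gamma> w)) (- d) - blinfun_apply (J (blinfun_apply \<gamma> p)) (- d)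
        = blinfun_apply (J d - J d') (- d)"
      unfolding split[symmetric] by (simp add: blinfun.diff_left)
    also have "\<dots> = blinfun_apply (J d') d - blinfun_apply (J d) d"
      by (simp add: blinfun.diff_left blinfun.minus_right)
    finally show ?thesis using lagged coercive[of d] by linarith
  qed
  have operators: "blinfun_apply (A w) (u - w) = - blinfun_apply (A u) (w - u) - blinfun_apply (A w - A u) (w - u)"
    and load: "blinfun_apply l (u - w) = - blinfun_apply l (w - u)"
    unfolding flip(2) by (simp_all only: blinfun.minus_right blinfun.diff_left)
  have "blinfun_apply (A w - A u) (w - u)
      \<le> a * norm (u - p) * norm (u - w) + b * c\<^sup>2 * (norm (p - u) * norm (w - u))"
    using solution step[unfolded flip(1)] D_sum stabilizer freezing operators load
    unfolding d_def[symmetric] by linarith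
  also have "\<dots> = ((a + b * c\<^sup>2) * norm (p - u)) * norm (w - u)"
    by (simp add: norm_minus_commute algebra_simps)
  finally have "(m * norm (w - u)) * norm (w - u) \<le> ((a + b * c\<^sup>2) * norm (p - u)) * norm (w - u)"
    using monotone by (simp add: power2_eq_square mult_ac)
  moreover have "0 \<le> (a + b * c\<^sup>2) * norm (p - u)"
    using a b by simp
  ultimately have "m * norm (w - u) \<le> (a + b * c\<^sup>2) * norm (p - u)"
    by (cases "w = u") auto
  then show ?thesis
    using m by (simp add: field_simps)
qed

lemma linear_rate_imp_tendsto:
  fixes w :: "nat \<Rightarrow> 'a::real_normed_vector"
  assumes "0 \<le> r" "r < 1" and step: "\<And>i. norm (w (Suc i) - x) \<le> r * norm (w i - x)"
  shows "w \<longlonglongrightarrow> x"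
proof -
  have bound: "norm (w i - x) \<le> r ^ i * norm (w 0 - x)" for i
  proof (induction i)
    case (Suc i)
    have "norm (w (Suc i) - x) \<le> r * (r ^ i * norm (w 0 - x))"
      using step[of i] mult_left_mono[OF Suc \<open>0 \<le> r\<close>] by linarith
    then show ?case by (simp add: mult_ac)
  qed simp
  have "(\<lambda>i. r ^ i * norm (w 0 - x)) \<longlonglongrightarrow> 0"
    using assms(1,2) by (intro tendsto_mult_left_zero LIMSEQ_realpow_zero)
  then have "(\<lambda>i. w i - x) \<longlonglongrightarrow> 0"
    by (rule Lim_null_comparison[OF always_eventually[OF allI[OF bound]]])
  then show ?thesis by (simp add: LIM_zero_iff)
qed

theorem theorem28:
  fixes K :: "'x::banach set"
    and \<gamma>\<^sub>j :: "'x \<Rightarrow>\<^sub>L 'z::banach"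
    and A :: "'x \<Rightarrow> 'x dual"
    and \<phi> :: "'y::real_normed_vector \<Rightarrow> 'x \<Rightarrow> 'x \<Rightarrow> real"
    and j :: "'z \<Rightarrow> real"
    and f :: "real \<Rightarrow> 'x dual"
    and R :: "'x \<Rightarrow>\<^sub>L 'y"
    and q :: "real \<times> real \<Rightarrow> 'x \<Rightarrow>\<^sub>L 'x"
    and a\<^sub>S :: 'x
    and j\<^sub>c :: "'z \<Rightarrow> 'z dual"
    and c\<^sub>j L\<^sub>A m\<^sub>A \<alpha>\<^sub>\<phi> \<beta>\<^sub>\<phi> c\<^sub>0 c\<^sub>1 \<alpha>\<^sub>j \<alpha>\<^sub>c \<rho> :: real
    and Hs :: "real set"
    and Xh Kh :: "real \<Rightarrow> 'x set"
    and T k h :: real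
    and N n :: nat
    and u w :: "nat \<Rightarrow> 'x"
  assumes X_reflexive: "reflexive TYPE('x)"
    and K_closed: "closed K" and K_convex: "convex K" and zero_in_K: "0 \<in> K"
    and c\<^sub>j_pos: "c\<^sub>j > 0"
    and \<gamma>\<^sub>j_bound: "\<And>v. norm (blinfun_apply \<gamma>\<^sub>j v) \<le> c\<^sub>j * norm v"
    and L\<^sub>A_pos: "L\<^sub>A > 0"
    and A_lipschitz: "L\<^sub>A-lipschitz_on UNIV A"
    and m\<^sub>A_pos: "m\<^sub>A > 0"
    and A_strongly_monotone:
      "\<And>v1 v2. blinfun_apply (A v1 - A v2) (v1 - v2) \<ge> m\<^sub>A * (norm (v1 - v2))\<^sup>2"
    and \<phi>_convex: "\<And>y v. v \<in> K \<Longrightarrow> convex_on K (\<phi> y v)"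
    and \<phi>_lsc: "\<And>y v. v \<in> K \<Longrightarrow> lsc_on K (\<phi> y v)"
    and \<alpha>\<^sub>\<phi>_pos: "\<alpha>\<^sub>\<phi> > 0" and \<beta>\<^sub>\<phi>_pos: "\<beta>\<^sub>\<phi> > 0"
    and \<phi>_bound:
      "\<And>y1 y2 u1 u2 v1 v2. \<lbrakk>u1 \<in> K; u2 \<in> K; v1 \<in> K; v2 \<in> K\<rbrakk> \<Longrightarrow>
         \<phi> y1 u1 v2 - \<phi> y1 u1 v1 + \<phi> y2 u2 v1 - \<phi> y2 u2 v2
           \<le> \<alpha>\<^sub>\<phi> * norm (u1 - u2) * norm (v1 - v2) + \<beta>\<^sub>\<phi> * norm (y1 - y2) * norm (v1 - v2)"
    and j_loc_lipschitz: "locally_lipschitz j"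
    and c\<^sub>0_nonneg: "c\<^sub>0 \<ge> 0" and c\<^sub>1_nonneg: "c\<^sub>1 \<ge> 0"
    and j_growth: "\<And>z \<xi>. \<xi> \<in> clarke_subdiff j z \<Longrightarrow> norm \<xi> \<le> c\<^sub>0 + c\<^sub>1 * norm z"
    and \<alpha>\<^sub>j_pos: "\<alpha>\<^sub>j > 0"
    and j_relaxed:
      "\<And>z1 z2. clarke_deriv j z1 (z2 - z1) + clarke_deriv j z2 (z1 - z2)
         \<le> \<alpha>\<^sub>j * (norm (z1 - z2))\<^sup>2"
    and f_cont: "continuous_on {0..} f"
    and q_cont: "continuous_on ({0..} \<times> {0..}) q"
    and small: "\<alpha>\<^sub>\<phi> + \<alpha>\<^sub>j * c\<^sub>j\<^sup>2 < m\<^sub>A"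
    and j\<^sub>c_linear: "linear j\<^sub>c"
    and \<alpha>\<^sub>c_nonneg: "\<alpha>\<^sub>c \<ge> 0"
    and j\<^sub>c_bound: "\<And>z. norm (j\<^sub>c z) \<le> \<alpha>\<^sub>c * norm z"
    and j\<^sub>c_coercive: "\<And>z. blinfun_apply (j\<^sub>c z) z \<ge> \<alpha>\<^sub>j * (norm z)\<^sup>2"
    and rate: "\<rho> = (\<alpha>\<^sub>\<phi> + \<alpha>\<^sub>c * c\<^sub>j\<^sup>2) / m\<^sub>A"
    and mesh_pos: "\<And>h'. h' \<in> Hs \<Longrightarrow> h' > 0"
    and Xh_fin_dim: "\<And>h'. h' \<in> Hs \<Longrightarrow> finite_dim_subspace (Xh h')"
    and Kh_eq: "\<And>h'. h' \<in> Hs \<Longrightarrow> Kh h' = Xh h' \<inter> K"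
    and T_pos: "T > 0" and N_pos: "N > 0" and k_eq: "k = T / real N"
    and n_range: "1 \<le> n" "n \<le> N"
    and h_mesh: "h \<in> Hs"
    and u_history: "\<And>m. m < n \<Longrightarrow> u m \<in> Kh h"
    and u_n_mem: "u n \<in> Kh h"
    and u_n_solves: "\<And>v. v \<in> Kh h \<Longrightarrow>
         blinfun_apply (A (u n)) (v - u n)
         + \<phi> (S_disc R q a\<^sub>S k n u) (u n) v - \<phi> (S_disc R q a\<^sub>S k n u) (u n) (u n)
         + clarke_deriv j (blinfun_apply \<gamma>\<^sub>j (u n))
             (blinfun_apply \<gamma>\<^sub>j v - blinfun_apply \<gamma>\<^sub>j (u n))
         \<ge> blinfun_apply (f (real n * k)) (v - u n)"
    and w_mem: "\<And>i. w i \<in> Kh h"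
    and w_iteration: "\<And>i v. \<lbrakk>i \<ge> 1; v \<in> Kh h\<rbrakk> \<Longrightarrow>
         blinfun_apply (A (w i)) (v - w i)
         + \<phi> (S_disc R q a\<^sub>S k n u) (w (i - 1)) v - \<phi> (S_disc R q a\<^sub>S k n u) (w (i - 1)) (w i)
         + clarke_deriv j (blinfun_apply \<gamma>\<^sub>j (w i))
             (blinfun_apply \<gamma>\<^sub>j v - blinfun_apply \<gamma>\<^sub>j (w i))
         + blinfun_apply (j\<^sub>c (blinfun_apply \<gamma>\<^sub>j (w i)))
             (blinfun_apply \<gamma>\<^sub>j v - blinfun_apply \<gamma>\<^sub>j (w i))
         \<ge> blinfun_apply (f (real n * k)) (v - w i)
         + blinfun_apply (j\<^sub>c (blinfun_apply \<gamma>\<^sub>j (w (i - 1))))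
             (blinfun_apply \<gamma>\<^sub>j v - blinfun_apply \<gamma>\<^sub>j (w i))"
  shows "(\<forall>i\<ge>1. norm (w i - u n) \<le> \<rho> * norm (w (i - 1) - u n))
       \<and> (\<rho> < 1 \<longrightarrow> w \<longlonglongrightarrow> u n)"
proof -
  have inK: "v \<in> K" if "v \<in> Kh h" for v
    using that Kh_eq[OF h_mesh] by simp
  have contraction: "norm (w i - u n) \<le> \<rho> * norm (w (i - 1) - u n)" if "i \<ge> 1" for i
  proof -
    let ?\<psi> = "\<phi> (S_disc R q a\<^sub>S k n u)"
    have freezing: "?\<psi> (u n) (w i) - ?\<psi> (u n) (u n) + ?\<psi> (w (i - 1)) (u n) - ?\<psi> (w (i - 1)) (w i)
        \<le> \<alpha>\<^sub>\<phi> * norm (u n - w (i - 1)) * norm (u n - w i)"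
      using \<phi>_bound[of "u n" "w (i - 1)" "u n" "w i" "S_disc R q a\<^sub>S k n u" "S_disc R q a\<^sub>S k n u"]
        inK u_n_mem w_mem by simp
    show ?thesis
      unfolding rate
    proof (rule stabilized_step_contraction[where A = A and \<gamma> = \<gamma>\<^sub>j and \<psi> = ?\<psi>
          and D = "clarke_deriv j" and J = j\<^sub>c and l = "f (real n * k)" and \<alpha> = \<alpha>\<^sub>j])
      show "0 \<le> c\<^sub>j" "0 \<le> \<alpha>\<^sub>\<phi>"
        using c\<^sub>j_pos \<alpha>\<^sub>\<phi>_pos by simp_all
    qed (fact m\<^sub>A_pos \<alpha>\<^sub>c_nonneg A_strongly_monotone \<gamma>\<^sub>j_bound freezing j_relaxed j\<^sub>c_linear j\<^sub>c_bound
        j\<^sub>c_coercive u_n_solves[OF w_mem] w_iteration[OF that u_n_mem])+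
  qed
  have "\<rho> \<ge> 0"
    using rate m\<^sub>A_pos \<alpha>\<^sub>\<phi>_pos \<alpha>\<^sub>c_nonneg by simp
  then have "w \<longlonglongrightarrow> u n" if "\<rho> < 1"
    using that contraction[of "Suc _"] by (intro linear_rate_imp_tendsto[of \<rho>]) auto
  with contraction show ?thesis by blast
qed

end
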